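(* Let $a,b>0$ be integers, $Q(z)=(1+az)(1+bz)$, and let $(H_n(x))_{n\ge0}$ be the polynomials defined by $\sum_{n\ge 0}H_n(x)\frac{z^n}{n!}=Q(z)^xQ(-z)^{1-x}$. Define $c_{n,k}$ by $H_n(x)=\sum_{k=0}^n c_{n,k}(x)_k$. For $k=0,1,\ldots,n$, let $\sigma(n,k)$ denote the sum of the weights of the lattice paths in the plane from $(0,0)$ to $(n,k)$ with steps in $\{U,H,H^2\}$, with step weights $\omega(U)=2(a+b)$, $\omega_{ij}(H)=(i+j-2)(a+b)$ and $\omega_{ij}(H^2)=-(i-1)(i+2j-4)ab$. Then $$\sigma(n,k)=c_{n,k}=\frac{n!}{k!}\,[z^n]\,Q(-z)\left(\frac{Q(z)}{Q(-z)}-1\right)^k.$$ In particular, $$[x^k]H_n(x)=\sum_{i=0}^n(-1)^{i+k}\sigma(n,i)\,s(i,k).$$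
   Context: The steps are the up-step $U=(1,1)$, the level-step $H=(1,0)$ and the double level-step $H^2=(2,0)$. Every $U$ step has weight $\omega(U)$; $\omega_{ij}(H)$ is the weight of the step $H$ from $(i-1,j)$ to $(i,j)$, and $\omega_{ij}(H^2)$ is the weight of the step $H^2$ from $(i-2,j)$ to $(i,j)$. The weight of a path is the product of the weights of its steps (the empty path has weight $1$); a double level-step is a single step, distinct from two consecutive level-steps. $(x)_k=\prod_{i=0}^{k-1}(x-i)$ is the falling factorial, $(x)_0=1$. $[z^n]$ and $[x^k]$ denote coefficient extraction. $s(i,k)$ denotes the unsigned Stirling number of the first kind, so that $(x)_i=\sum_{k=0}^i(-1)^{i+k}s(i,k)x^k$. *)

theory Defs
  imports
    "HOL-Computational_Algebra.Polynomial"
    "HOL-Computational_Algebra.Formal_Power_Series"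
    "HOL-Combinatorics.Stirling"
begin

datatype step = Up | Level | DLevel

fun shift :: "step \<Rightarrow> int \<times> int" where
  "shift Up = (1, 1)"
| "shift Level = (1, 0)"
| "shift DLevel = (2, 0)"

fun path_end :: "int \<times> int \<Rightarrow> step list \<Rightarrow> int \<times> int" where
  "path_end P [] = P"
| "path_end P (s # p) = path_end (fst P + fst (shift s), snd P + snd (shift s)) p"

text \<open>A step weight \<open>w s (i, j)\<close> is indexed by the \<^emph>\<open>end\<close> point \<open>(i, j)\<close> of the step \<open>s\<close>.\<close>

fun path_weight ::
  "(step \<Rightarrow> int \<times> int \<Rightarrow> int) \<Rightarrow> int \<times> int \<Rightarrow> step list \<Rightarrow> int"
where
  "path_weight w P [] = 1"
| "path_weight w P (s # p) =
     (let P' = (fst P + fst (shift s), snd P + snd (shift s))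
      in w s P' * path_weight w P' p)"

definition lattice_paths :: "int \<times> int \<Rightarrow> int \<times> int \<Rightarrow> step list set" where
  "lattice_paths P R = {p. path_end P p = R}"

fun \<omega> :: "int \<Rightarrow> int \<Rightarrow> step \<Rightarrow> int \<times> int \<Rightarrow> int" where
  "\<omega> a b Up (i, j) = 2 * (a + b)"
| "\<omega> a b Level (i, j) = (i + j - 2) * (a + b)"
| "\<omega> a b DLevel (i, j) = - (i - 1) * (i + 2 * j - 4) * a * b"

definition \<sigma> :: "int \<Rightarrow> int \<Rightarrow> nat \<Rightarrow> nat \<Rightarrow> int" where
  "\<sigma> a b n k =
     (\<Sum>p\<in>lattice_paths (0, 0) (int n, int k). path_weight (\<omega> a b) (0, 0) p)"

lemma length_le_path_end: "fst P + int (length p) \<le> fst (path_end P p)"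
proof (induction p arbitrary: P)
  case (Cons s p)
  have "1 \<le> fst (shift s)" by (cases s) auto
  with Cons[of "(fst P + fst (shift s), snd P + snd (shift s))"] show ?case by simp
qed simp

lemma finite_lattice_paths: "finite (lattice_paths P R)"
proof (rule finite_subset)
  show "lattice_paths P R \<subseteq> {p. set p \<subseteq> {Up, Level, DLevel} \<and> length p \<le> nat (fst R - fst P)}"
  proof
    fix p assume "p \<in> lattice_paths P R"
    then have "length p \<le> nat (fst R - fst P)"
      using length_le_path_end[of P p] by (simp add: lattice_paths_def)
    moreover have "set p \<subseteq> {Up, Level, DLevel}"
    proof
      fix s show "s \<in> {Up, Level, DLevel}" by (cases s) simp_all
    qed
    ultimately show "p \<in> {p. set p \<subseteq> {Up, Level, DLevel} \<and> length p \<le> nat (fst R - fst P)}"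
      by simp
  qed
  show "finite {p. set p \<subseteq> {Up, Level, DLevel} \<and> length p \<le> nat (fst R - fst P)}"
    by (rule finite_lists_length_le) simp
qed

definition falling :: "'a::comm_ring_1 \<Rightarrow> nat \<Rightarrow> 'a" where
  "falling x k = (\<Prod>i<k. x - of_nat i)"

text \<open>\<open>z\<close> will be a power series, so that \<open>Q a b fps_X\<close> is $Q(z)$ and
  \<open>Q a b (- fps_X)\<close> is $Q(-z)$.\<close>

definition Q :: "int \<Rightarrow> int \<Rightarrow> 'a::comm_ring_1 \<Rightarrow> 'a" where
  "Q a b z = (1 + of_int a * z) * (1 + of_int b * z)"

text \<open>For a power series $F$ with constant coefficient 1, the power $F^x$ is the binomial series
  $\sum_k {x \choose k} (F - 1)^k$. The coefficients are polynomials in an indeterminate and the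
  exponent is such a polynomial. (The constant \<open>fps_binomial\<close> needs coefficients from a field; the
  two agree after evaluation of the indeterminate, see below.)\<close>

definition fps_gpow :: "'a::field_char_0 poly fps \<Rightarrow> 'a poly \<Rightarrow> 'a poly fps" where
  "fps_gpow F x = fps_compose (Abs_fps (\<lambda>k. smult (1 / fact k) (falling x k))) (F - 1)"

lemma poly_falling: "poly (falling p k) t = falling (poly p t) k"
  by (simp add: falling_def poly_prod)

lemma poly_fps_gpow:
  fixes F :: "'a::field_char_0 poly fps"
  shows "Abs_fps (\<lambda>n. poly (fps_nth (fps_gpow F p) n) t) =
           fps_compose (fps_binomial (poly p t)) (Abs_fps (\<lambda>n. poly (fps_nth F n) t) - 1)"
proof (rule fps_ext)
  fix n
  define G where "G = Abs_fps (\<lambda>n. poly (fps_nth F n) t) - 1"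
  have G: "fps_nth (G ^ i) m = poly (fps_nth ((F - 1) ^ i) m) t" for i m
    by (induction i arbitrary: m) (auto simp: fps_mult_nth poly_sum G_def intro!: sum.cong)
  show "fps_nth (Abs_fps (\<lambda>n. poly (fps_nth (fps_gpow F p) n) t)) n =
          fps_nth (fps_compose (fps_binomial (poly p t)) (Abs_fps (\<lambda>n. poly (fps_nth F n) t) - 1)) n"
    unfolding G_def[symmetric]
    by (simp add: fps_gpow_def fps_compose_nth poly_sum G poly_falling fps_binomial_def
        gbinomial_prod_rev falling_def[of "poly p t"] atLeast0LessThan)
qed

text \<open>Every polynomial sequence $(H_m)$ with $\deg H_m \le m$ has coefficients with respect to the
  falling factorials, and the generating function below defines such a sequence.\<close>

lemma degree_falling: "degree (falling [:0, 1::'a::field_char_0:] k) = k"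
  and lead_coeff_falling: "coeff (falling [:0, 1::'a:] k) k = 1"
proof -
  have *: "falling [:0, 1::'a:] k = (\<Prod>i<k. [:- of_nat i, 1:])"
    by (simp add: falling_def of_nat_poly)
  show d: "degree (falling [:0, 1::'a:] k) = k"
    unfolding * by (subst degree_prod_eq_sum_degree) auto
  have "lead_coeff (falling [:0, 1::'a:] k) = 1"
    unfolding * by (simp add: lead_coeff_prod)
  with d show "coeff (falling [:0, 1::'a:] k) k = 1" by simp
qed

lemma ex_falling_coeffs:
  fixes p :: "'a::field_char_0 poly"
  assumes "degree p \<le> n"
  shows "\<exists>c. p = (\<Sum>k\<le>n. smult (c k) (falling [:0, 1:] k))"
  using assms
proof (induction n arbitrary: p)
  case 0
  then show ?case
    by (auto elim!: degree_eq_zeroE simp: falling_def intro!: exI[of _ "\<lambda>_. coeff p 0"])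
next
  case (Suc n)
  define q where "q = p - smult (coeff p (Suc n)) (falling [:0, 1:] (Suc n))"
  have "degree q \<le> n"
  proof (rule degree_le, intro allI impI)
    fix i assume "n < i"
    show "coeff q i = 0"
    proof (cases "i = Suc n")
      case True
      then show ?thesis by (simp add: q_def lead_coeff_falling)
    next
      case False
      with \<open>n < i\<close> have "Suc n < i" by simp
      then show ?thesis using Suc.prems
        by (simp add: q_def coeff_eq_0 degree_falling)
    qed
  qed
  from Suc.IH[OF this] obtain c where c: "q = (\<Sum>k\<le>n. smult (c k) (falling [:0, 1:] k))"
    by blast
  show ?case
    by (rule exI[of _ "c(Suc n := coeff p (Suc n))"]) (simp add: c[symmetric] q_def)
qed

lemma degree_fps_mult_0:
  fixes F G :: "'a::field_char_0 poly fps"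
  assumes "\<And>m. degree (fps_nth F m) = 0" "\<And>m. degree (fps_nth G m) = 0"
  shows "degree (fps_nth (F * G) m) = 0"
proof -
  have "degree (\<Sum>j=0..m. fps_nth F j * fps_nth G (m - j)) \<le> 0"
  proof (rule degree_sum_le)
    fix j
    show "degree (fps_nth F j * fps_nth G (m - j)) \<le> 0"
      using degree_mult_le[of "fps_nth F j" "fps_nth G (m - j)"] assms by simp
  qed simp
  then show ?thesis by (simp add: fps_mult_nth)
qed

lemma degree_fps_gpow:
  fixes F :: "'a::field_char_0 poly fps"
  assumes "\<And>m. degree (fps_nth F m) = 0" and "degree p \<le> 1"
  shows "degree (fps_nth (fps_gpow F p) n) \<le> n"
proof -
  have F1: "degree (fps_nth (F - 1) m) = 0" for m
    using degree_diff_le[of "fps_nth F m" 0 "fps_nth 1 m"] assms(1)[of m]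
    by (simp add: fps_one_nth)
  have 0: "degree (fps_nth ((F - 1) ^ i) m) = 0" for i m
  proof (induction i arbitrary: m)
    case (Suc i)
    show ?case unfolding power_Suc by (rule degree_fps_mult_0[OF F1 Suc])
  qed (simp add: fps_one_nth)
  have f: "degree (falling p k) \<le> k" for k
  proof (induction k)
    case (Suc k)
    have "falling p (Suc k) = falling p k * (p - of_nat k)" by (simp add: falling_def)
    moreover have "degree (p - of_nat k) \<le> 1"
      using assms(2) by (intro degree_diff_le) auto
    ultimately show ?case
      using degree_mult_le[of "falling p k" "p - of_nat k"] Suc by simp
  qed (simp add: falling_def)
  show ?thesis
    unfolding fps_gpow_def fps_compose_nth fps_nth_Abs_fps
  proof (rule degree_sum_le)
    fix i assume "i \<in> {0..n}"
    have "degree (smult (1 / fact i) (falling p i) * fps_nth ((F - 1) ^ i) n)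
        \<le> degree (smult (1 / fact i) (falling p i)) + degree (fps_nth ((F - 1) ^ i) n)"
      by (rule degree_mult_le)
    also have "\<dots> \<le> i" using f[of i] 0[of i n] by simp
    also have "i \<le> n" using \<open>i \<in> _\<close> by simp
    finally show "degree (smult (1 / fact i) (falling p i) * fps_nth ((F - 1) ^ i) n) \<le> n" .
  qed simp
qed

lemma degree_Q:
  fixes z :: "'a::field_char_0 poly fps"
  assumes "z = fps_X \<or> z = - fps_X"
  shows "degree (fps_nth (Q a b z) n) = 0"
proof -
  have "degree (fps_nth (1 + of_int c * z) m) = 0" for c m
  proof -
    have "fps_nth (1 + of_int c * z) m =
        (if m = 0 then 1 else if m = 1 then of_int c * fps_nth z 1 else 0)"
      using assms by (auto simp: fps_one_nth simp flip: fps_of_int)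
    moreover have "of_int c * fps_nth z 1 = of_int c \<or> of_int c * fps_nth z 1 = of_int (- c)"
      using assms by auto
    ultimately show ?thesis by (auto simp del: of_int_minus)
  qed
  then show ?thesis unfolding Q_def by (intro degree_fps_mult_0)
qed

lemma ex_H_and_coeffs:
  "\<exists>(H :: nat \<Rightarrow> 'a::field_char_0 poly) c.
     Abs_fps (\<lambda>m. smult (1 / fact m) (H m)) =
       fps_gpow (Q a b fps_X) [:0, 1:] * fps_gpow (Q a b (- fps_X)) (1 - [:0, 1:]) \<and>
     (\<forall>m. H m = (\<Sum>k\<le>m. smult (c m k) (falling [:0, 1:] k)))"
proof -
  define G :: "'a poly fps" where
    "G = fps_gpow (Q a b fps_X) [:0, 1:] * fps_gpow (Q a b (- fps_X)) (1 - [:0, 1:])"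
  define H where "H m = smult (fact m) (fps_nth G m)" for m
  have "degree (fps_nth G m) \<le> m" for m
    unfolding G_def fps_mult_nth
  proof (rule degree_sum_le)
    fix i assume "i \<in> {0..m}"
    let ?f = "fps_nth (fps_gpow (Q a b fps_X) [:0, 1::'a:]) i"
    let ?g = "fps_nth (fps_gpow (Q a b (- fps_X)) (1 - [:0, 1::'a:])) (m - i)"
    have "degree (?f * ?g) \<le> degree ?f + degree ?g" by (rule degree_mult_le)
    also have "\<dots> \<le> i + (m - i)"
      by (intro add_mono degree_fps_gpow degree_Q) (auto intro: degree_diff_le)
    also have "\<dots> = m" using \<open>i \<in> _\<close> by simp
    finally show "degree (?f * ?g) \<le> m" .
  qed simp
  then have "degree (H m) \<le> m" for m by (simp add: H_def)
  then have "\<forall>m. \<exists>c. H m = (\<Sum>k\<le>m. smult (c k) (falling [:0, 1:] k))"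
    using ex_falling_coeffs by blast
  then obtain c where "\<forall>m. H m = (\<Sum>k\<le>m. smult (c m k) (falling [:0, 1:] k))"
    by metis
  moreover have "Abs_fps (\<lambda>m. smult (1 / fact m) (H m)) = G"
    by (simp add: fps_eq_iff H_def)
  ultimately show ?thesis unfolding G_def by blast
qed

end

theory Submission
  imports Defs
begin

text \<open>Write \<open>W(z) = Q(z) / Q(-z) - 1\<close>. Since \<open>Q(z) - Q(-z) = 2 (a + b) z\<close> is a monomial,
  \<open>Q(-z) W(z) = 2 (a + b) z\<close>, and this one identity drives the proof.

  At a natural number \<open>x = t\<close> the generating function of the \<open>H\<^sub>n\<close> is
  \<open>Q(z)\<^sup>t Q(-z)\<^sup>1\<^sup>-\<^sup>t = Q(-z) (1 + W(z))\<^sup>t\<close>, and the binomial theorem turns it into the sum of the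
  \<open>(t)\<^sub>k / k!\<close> times the series \<open>F\<^sub>k = Q(-z) W(z)\<^sup>k\<close> (lemma \<open>generating_function_at_nat\<close>). The values
  at the natural numbers determine the coefficients with respect to the falling factorials
  (lemma \<open>falling_coeffs_unique\<close>), so \<open>c\<^sub>n\<^sub>,\<^sub>k\<close> is \<open>n!/k!\<close> times the \<open>n\<close>-th coefficient of \<open>F\<^sub>k\<close>.

  Differentiating \<open>F\<^sub>k\<close> with the help of the identity above gives the linear differential equation
  \<open>Q(-z) z F\<^sub>k' = 2 (a + b) k z F\<^sub>k\<^sub>-\<^sub>1 + (1 - k) z (Q(-z))' F\<^sub>k\<close> (lemma \<open>column_ode\<close>). As \<open>Q(-z)\<close>
  is quadratic, comparing coefficients yields a recurrence with three terms, from the entries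
  \<open>(n-1, k-1)\<close>, \<open>(n-1, k)\<close> and \<open>(n-2, k)\<close>. After scaling by \<open>n!/k!\<close> it is exactly the recurrence
  that the lattice paths satisfy by removal of their last step (lemma \<open>\<sigma>_Suc\<close>), one kind
  of step for each of the three terms.\<close>

section \<open>Decomposing lattice paths by their last step\<close>

lemma path_end_append: "path_end P (p @ q) = path_end (path_end P p) q"
  by (induction P p rule: path_end.induct) auto

lemma path_weight_append:
  "path_weight w P (p @ q) = path_weight w P p * path_weight w (path_end P p) q"
  by (induction w P p rule: path_weight.induct) (auto simp: Let_def mult.assoc)

lemma lattice_paths_last_step:
  assumes "(i, j) \<noteq> P"
  shows "lattice_paths P (i, j) =
    (\<lambda>(s, p). p @ [s]) ` (SIGMA s : {Up, Level, DLevel}.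
      lattice_paths P (i - fst (shift s), j - snd (shift s)))" (is "?L = ?f ` ?S")
proof
  show "?f ` ?S \<subseteq> ?L"
    by (auto simp: lattice_paths_def path_end_append)
  show "?L \<subseteq> ?f ` ?S"
  proof
    fix q assume q: "q \<in> ?L"
    have "q \<noteq> []" using q assms by (auto simp: lattice_paths_def)
    then obtain p s where ps: "q = p @ [s]" by (metis rev_exhaust)
    have "(s, p) \<in> ?S"
      using q by (cases s) (auto simp: ps lattice_paths_def path_end_append prod_eq_iff)
    then show "q \<in> ?f ` ?S" using ps by force
  qed
qed

lemma sum_path_weight_last_step:
  assumes "(i, j) \<noteq> P"
  shows "(\<Sum>q\<in>lattice_paths P (i, j). path_weight w P q) =
    (\<Sum>s\<in>{Up, Level, DLevel}. w s (i, j) *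
      (\<Sum>p\<in>lattice_paths P (i - fst (shift s), j - snd (shift s)). path_weight w P p))"
proof -
  let ?L = "\<lambda>s. lattice_paths P (i - fst (shift s), j - snd (shift s))"
  have "inj_on (\<lambda>(s, p). p @ [s]) (SIGMA s : {Up, Level, DLevel}. ?L s)"
    by (auto simp: inj_on_def)
  then have "(\<Sum>q\<in>lattice_paths P (i, j). path_weight w P q) =
      (\<Sum>(s, p)\<in>(SIGMA s : {Up, Level, DLevel}. ?L s). path_weight w P (p @ [s]))"
    by (subst lattice_paths_last_step[OF assms], subst sum.reindex) (auto simp: case_prod_beta)
  also have "\<dots> = (\<Sum>s\<in>{Up, Level, DLevel}. \<Sum>p\<in>?L s. path_weight w P (p @ [s]))"
    by (rule sum.Sigma[symmetric]) (auto simp: finite_lattice_paths)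
  also have "\<dots> = (\<Sum>s\<in>{Up, Level, DLevel}. w s (i, j) * (\<Sum>p\<in>?L s. path_weight w P p))"
    unfolding sum_distrib_left
    by (intro sum.cong refl) (auto simp: path_weight_append lattice_paths_def)
  finally show ?thesis .
qed

lemma snd_path_end_ge: "snd P \<le> snd (path_end P p)"
proof (induction p arbitrary: P)
  case (Cons s p)
  have "0 \<le> snd (shift s)" by (cases s) auto
  with Cons[of "(fst P + fst (shift s), snd P + snd (shift s))"] show ?case by simp
qed simp

text \<open>No step goes down. In the last-step recurrence for \<open>\<sigma>\<close> this kills the contribution of an up-step
  that ends at height \<open>0\<close>.\<close>

lemma lattice_paths_below:
  assumes "j < snd P"
  shows "lattice_paths P (i, j) = {}"
proof -
  have False if "path_end P p = (i, j)" for p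
    using assms snd_path_end_ge[of P p] that by simp
  then show ?thesis by (auto simp: lattice_paths_def)
qed

lemma \<sigma>_0: "\<sigma> a b 0 k = (if k = 0 then 1 else 0)"
proof -
  have "path_end (0, 0) p = (0, int k) \<longleftrightarrow> p = [] \<and> k = 0" for p
  proof
    assume p: "path_end (0, 0) p = (0, int k)"
    then have "p = []" using length_le_path_end[of "(0, 0)" p] by simp
    with p show "p = [] \<and> k = 0" by simp
  qed simp
  then have "lattice_paths (0, 0) (0, int k) = (if k = 0 then {[]} else {})"
    by (auto simp: lattice_paths_def)
  then show ?thesis by (simp add: \<sigma>_def)
qed

text \<open>For \<open>m = 0\<close> the truncated \<open>m - 1\<close> is harmless: a double level-step ending at abscissa \<open>1\<close>
  has weight \<open>0\<close>.\<close>

lemma \<sigma>_Suc: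
  "\<sigma> a b (Suc m) k =
     2 * (a + b) * (if k = 0 then 0 else \<sigma> a b m (k - 1)) +
     (int m + int k - 1) * (a + b) * \<sigma> a b m k -
     int m * (int m + 2 * int k - 3) * a * b * \<sigma> a b (m - 1) k"
proof -
  let ?S = "\<lambda>i j. \<Sum>p\<in>lattice_paths (0, 0) (i, j). path_weight (\<omega> a b) (0, 0) p"
  have "\<sigma> a b (Suc m) k = 2 * (a + b) * ?S (int m) (int k - 1) +
      (int m + int k - 1) * (a + b) * ?S (int m) (int k) +
      - (int m + 2 * int k - 3) * a * b * (int m * ?S (int m - 1) (int k))"
    unfolding \<sigma>_def by (subst sum_path_weight_last_step) (auto simp: algebra_simps)
  moreover have "?S (int m) (int k - 1) = (if k = 0 then 0 else \<sigma> a b m (k - 1))"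
    by (auto simp: \<sigma>_def lattice_paths_below of_nat_diff)
  moreover have "int m * ?S (int m - 1) (int k) = int m * \<sigma> a b (m - 1) k"
    by (cases m) (auto simp: \<sigma>_def)
  moreover have "?S (int m) (int k) = \<sigma> a b m k" by (simp add: \<sigma>_def)
  ultimately have "\<sigma> a b (Suc m) k = 2 * (a + b) * (if k = 0 then 0 else \<sigma> a b m (k - 1)) +
      (int m + int k - 1) * (a + b) * \<sigma> a b m k +
      - (int m + 2 * int k - 3) * a * b * (int m * \<sigma> a b (m - 1) k)"
    by (simp only:)
  then show ?thesis by (simp add: algebra_simps)
qed

section \<open>The generating functions of the columns\<close>

text \<open>The column \<open>k\<close> of the array \<open>c\<^sub>n\<^sub>,\<^sub>k\<close> has exponential generating function
  \<open>column a b k / k!\<close>.\<close>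

definition column :: "int \<Rightarrow> int \<Rightarrow> nat \<Rightarrow> rat fps" where
  "column a b k = Q a b (- fps_X) * (Q a b fps_X / Q a b (- fps_X) - 1) ^ k"

lemma Q_nth_0: "fps_nth (Q a b fps_X :: 'a::comm_ring_1 fps) 0 = 1"
    "fps_nth (Q a b (- fps_X) :: 'a::comm_ring_1 fps) 0 = 1"
  by (simp_all add: Q_def)

lemma Q_quotient_mult:
  "Q a b (- fps_X) * (Q a b fps_X / Q a b (- fps_X)) = (Q a b fps_X :: 'a::field fps)"
proof -
  have q: "fps_nth (Q a b (- fps_X) :: 'a fps) 0 \<noteq> 0" by (simp add: Q_nth_0)
  have "Q a b (- fps_X) * (Q a b fps_X / Q a b (- fps_X)) =
      Q a b fps_X * (Q a b (- fps_X) * inverse (Q a b (- fps_X) :: 'a fps))"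
    unfolding fps_divide_unit[OF q] by (rule mult.left_commute)
  also have "\<dots> = Q a b fps_X" unfolding inverse_mult_eq_1'[OF q] by (rule mult_1_right)
  finally show ?thesis .
qed

lemma Q_mult_quotient_minus_1:
  "Q a b (- fps_X) * (Q a b fps_X / Q a b (- fps_X) - 1) =
    (of_int (2 * (a + b)) * fps_X :: 'a::field fps)"
  unfolding right_diff_distrib Q_quotient_mult by (simp add: Q_def algebra_simps)

text \<open>By the product rule \<open>z F' = z (Q(-z))' W\<^sup>k + k Q(-z) W\<^sup>k\<^sup>-\<^sup>1 z W'\<close>. The derivative of
  \<open>Q(-z) W = 2 (a + b) z\<close> eliminates \<open>Q(-z) W'\<close> and with it every derivative of the quotient, which
  leaves an equation with polynomial coefficients. For \<open>k = 0\<close> the truncated \<open>k - 1\<close> has the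
  factor \<open>0\<close>.\<close>

lemma column_ode:
  "Q a b (- fps_X) * fps_XD (column a b k) =
     of_nat k * of_int (2 * (a + b)) * fps_X * column a b (k - 1) +
     (1 - of_nat k) * fps_XD (Q a b (- fps_X)) * column a b k"
proof (cases k)
  case 0
  then show ?thesis by (simp add: column_def)
next
  case (Suc j)
  define q W :: "rat fps" where "q = Q a b (- fps_X)" and "W = Q a b fps_X / Q a b (- fps_X) - 1"
  define s :: "rat fps" where "s = of_int (2 * (a + b))"
  let ?D = "fps_deriv :: rat fps \<Rightarrow> rat fps"
  have q: "q * W = s * fps_X"
    unfolding q_def W_def s_def by (rule Q_mult_quotient_minus_1)
  have "?D (q * W) = s" unfolding q s_def by (simp flip: fps_of_int)
  then have d: "q * ?D W = s - ?D q * W" by (simp add: algebra_simps)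
  have "?D (W ^ k) = of_nat k * ?D W * W ^ j"
    by (simp add: Suc fps_deriv_power' del: power_Suc)
  then have "?D (q * W ^ k) = ?D q * W ^ k + of_nat k * W ^ j * (q * ?D W)"
    by (simp add: algebra_simps)
  also have "\<dots> = of_nat k * s * W ^ j + (1 - of_nat k) * ?D q * W ^ k"
    unfolding d by (simp add: Suc algebra_simps)
  finally have D: "?D (q * W ^ k) = of_nat k * s * W ^ j + (1 - of_nat k) * ?D q * W ^ k" .
  have "q * (fps_X * ?D (q * W ^ k)) =
      of_nat k * s * fps_X * (q * W ^ j) + (1 - of_nat k) * (fps_X * ?D q) * (q * W ^ k)"
    unfolding D by (simp add: algebra_simps)
  then show ?thesis
    unfolding column_def fps_XD_def o_apply q_def W_def s_def by (simp only: Suc diff_Suc_1)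
qed

lemma Q_expand: "Q a b y = 1 + of_int (a + b) * y + of_int (a * b) * y ^ 2"
  by (simp add: Q_def algebra_simps power2_eq_square)

lemma of_int_fps_nth_mult: "fps_nth (of_int c * f) n = of_int c * fps_nth f n"
  by (simp flip: fps_of_int)

lemma of_nat_fps_nth_mult: "fps_nth (of_nat c * f) n = of_nat c * fps_nth f n"
  by (simp flip: fps_of_nat)

lemma fps_X_square_mult_nth_Suc:
  "fps_nth (fps_X ^ 2 * f) (Suc m) = (if m = 0 then 0 else fps_nth f (m - 1))"
  by (simp add: fps_X_power_mult_nth)

text \<open>The coefficients at \<open>z\<^sup>m\<^sup>+\<^sup>1\<close> of the two sides of the differential equation.\<close>

lemma column_recurrence:
  fixes a b :: int
  defines "f \<equiv> \<lambda>k. fps_nth (column a b k)"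
  shows "of_nat (Suc m) * f k (Suc m) =
     of_nat k * of_int (2 * (a + b)) * f (k - 1) m +
     of_int ((int m + int k - 1) * (a + b)) * f k m -
     of_int ((int m + 2 * int k - 3) * (a * b)) * (if m = 0 then 0 else f k (m - 1))"
proof -
  let ?q = "Q a b (- fps_X) :: rat fps" and ?F = "column a b"
  have "?q * fps_XD (?F k) = fps_XD (?F k)
      - of_int (a + b) * (fps_X * fps_XD (?F k)) + of_int (a * b) * (fps_X ^ 2 * fps_XD (?F k))"
    by (simp add: Q_expand algebra_simps)
  then have L: "fps_nth (?q * fps_XD (?F k)) (Suc m) = of_nat (Suc m) * f k (Suc m)
      - of_int (a + b) * of_nat m * f k m
      + of_int (a * b) * (if m = 0 then 0 else of_nat (m - 1) * f k (m - 1))"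
    by (simp add: f_def of_int_fps_nth_mult fps_X_square_mult_nth_Suc
        del: of_nat_Suc of_int_add of_int_mult)
  have XD: "fps_XD ?q = of_int (- (a + b)) * fps_X + of_int (2 * (a * b)) * fps_X ^ 2"
    by (simp add: fps_XD_def Q_expand power2_eq_square algebra_simps)
  have "of_nat k * of_int (2 * (a + b)) * fps_X * ?F (k - 1) + (1 - of_nat k) * fps_XD ?q * ?F k
      = of_int (int k * (2 * (a + b))) * (fps_X * ?F (k - 1))
      + of_int ((1 - int k) * (- (a + b))) * (fps_X * ?F k)
      + of_int ((1 - int k) * (2 * (a * b))) * (fps_X ^ 2 * ?F k)"
    unfolding XD by (simp add: algebra_simps)
  then have R: "fps_nth (of_nat k * of_int (2 * (a + b)) * fps_X * ?F (k - 1)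
      + (1 - of_nat k) * fps_XD ?q * ?F k) (Suc m)
      = of_int (int k * (2 * (a + b))) * f (k - 1) m
      + of_int ((1 - int k) * (- (a + b))) * f k m
      + of_int ((1 - int k) * (2 * (a * b))) * (if m = 0 then 0 else f k (m - 1))"
    by (simp add: f_def of_int_fps_nth_mult fps_X_square_mult_nth_Suc
        del: of_nat_Suc of_int_add of_int_mult)
  show ?thesis
    using arg_cong[OF column_ode, of "\<lambda>g. fps_nth g (Suc m)" a b k] unfolding L R
    by (cases m) (auto simp: algebra_simps)
qed

text \<open>\<open>W\<close> has no constant term, so \<open>W\<^sup>k\<close> starts at \<open>z\<^sup>k\<close>.\<close>

lemma column_nth_eq_0: "m < k \<Longrightarrow> fps_nth (column a b k) m = 0"
proof -
  assume "m < k"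
  let ?W = "Q a b fps_X / Q a b (- fps_X) - 1 :: rat fps"
  have "fps_nth ?W 0 = 0"
    using arg_cong[OF Q_mult_quotient_minus_1, of "\<lambda>g. fps_nth g 0" a b]
    by (simp add: Q_nth_0)
  then have "fps_nth (?W ^ k) i = 0" if "i < k" for i
    using startsby_zero_power_prefix that by blast
  then show ?thesis
    using \<open>m < k\<close> by (auto simp: column_def fps_mult_nth intro!: sum.neutral)
qed

text \<open>With \<open>n = m + 1\<close>, both sides satisfy the same recurrence: \<open>m!/k!\<close> times the recurrence of the
  column turns each of its terms into the contribution of one kind of last step.\<close>

lemma \<sigma>_eq_column:
  "of_int (\<sigma> a b n k) = fact n / fact k * fps_nth (column a b k) n"
proof (induction n arbitrary: k rule: less_induct)
  case (less n)
  show ?case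
  proof (cases n)
    case 0
    have "fps_nth (column a b 0) 0 = 1" by (simp add: column_def Q_nth_0)
    with 0 show ?thesis by (auto simp: \<sigma>_0 column_nth_eq_0)
  next
    case (Suc m)
    let ?f = "\<lambda>k. fps_nth (column a b k)"
    have "of_int (2 * (a + b) * (if k = 0 then 0 else \<sigma> a b m (k - 1)))
       = fact m / fact k * (of_nat k * of_int (2 * (a + b)) * ?f (k - 1) m)"
      using less[of m "k - 1"] Suc by (cases k) (simp_all del: of_nat_Suc of_int_add)
    moreover have "of_int ((int m + int k - 1) * (a + b) * \<sigma> a b m k)
       = fact m / fact k * (of_int ((int m + int k - 1) * (a + b)) * ?f k m)"
      using less[of m k] Suc by simp
    moreover have "of_int (int m * (int m + 2 * int k - 3) * a * b * \<sigma> a b (m - 1) k)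
       = fact m / fact k * (of_int ((int m + 2 * int k - 3) * (a * b)) *
           (if m = 0 then 0 else ?f k (m - 1)))"
      using less[of "m - 1" k] Suc
      by (cases m) (simp_all del: of_nat_Suc of_int_add of_int_diff)
    ultimately have "of_int (\<sigma> a b n k) = fact m / fact k * (of_nat (Suc m) * ?f k (Suc m))"
      unfolding column_recurrence Suc \<sigma>_Suc
      by (simp only: of_int_add of_int_diff distrib_left right_diff_distrib)
    then show ?thesis by (simp add: Suc field_simps)
  qed
qed

section \<open>The falling factorial expansion\<close>

lemma falling_of_nat_eq_0: "t < k \<Longrightarrow> falling (of_nat t :: 'a::comm_ring_1) k = 0"
  by (auto simp: falling_def intro!: prod_zero)

lemma falling_of_nat: "falling (of_nat t :: 'a::field_char_0) k = fact k * of_nat (t choose k)"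
  by (simp add: falling_def gbinomial_prod_rev binomial_gbinomial atLeast0LessThan)

text \<open>The system of equations for \<open>t = 0, 1, \<dots>, n\<close> is triangular with the diagonal \<open>t!\<close>, because
  \<open>(t)\<^sub>k\<close> vanishes for \<open>t < k\<close>. So the evaluations at natural numbers suffice to compare
  coefficients.\<close>

lemma falling_coeffs_unique:
  fixes c d :: "nat \<Rightarrow> 'a::field_char_0"
  assumes eq: "\<And>t. (\<Sum>k\<le>n. c k * falling (of_nat t) k) = (\<Sum>k\<le>n. d k * falling (of_nat t) k)"
    and "k \<le> n"
  shows "c k = d k"
  using \<open>k \<le> n\<close>
proof (induction k rule: less_induct)
  case (less t)
  have "(\<Sum>k\<le>n. (c k - d k) * falling (of_nat t) k)
      = (\<Sum>k\<in>{t}. (c k - d k) * falling (of_nat t) k)"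
  proof (rule sum.mono_neutral_right)
    show "\<forall>k\<in>{..n} - {t}. (c k - d k) * falling (of_nat t) k = 0"
    proof
      fix k assume "k \<in> {..n} - {t}"
      then show "(c k - d k) * falling (of_nat t) k = 0"
        using less.IH[of k] falling_of_nat_eq_0[of t k] by (cases "k < t") auto
    qed
  qed (use less.prems in auto)
  moreover have "(\<Sum>k\<le>n. (c k - d k) * falling (of_nat t) k) = 0"
    using eq[of t] by (simp add: left_diff_distrib sum_subtractf)
  ultimately show ?case by (simp add: falling_of_nat)
qed

lemma poly_Q_nth:
  assumes "z = fps_X \<and> z' = fps_X \<or> z = - fps_X \<and> z' = - fps_X"
  shows "Abs_fps (\<lambda>n. poly (fps_nth (Q a b z) n) t) = (Q a b z' :: 'a::field_char_0 fps)"
  using assms unfolding Q_expand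
  by (intro fps_ext)
    (auto simp: of_int_fps_nth_mult fps_one_nth fps_X_power_iff simp del: of_int_add of_int_mult)

lemma fps_binomial_of_nat_compose:
  assumes "fps_nth (F :: 'a::field_char_0 fps) 0 = 1"
  shows "fps_compose (fps_binomial (of_nat t)) (F - 1) = F ^ t"
  using assms by (simp add: fps_binomial_of_nat fps_compose_power[symmetric] fps_compose_add_distrib)

text \<open>This characterizes \<open>F\<^sup>1\<^sup>-\<^sup>t\<close> without a case distinction on the sign of \<open>1 - t\<close>.\<close>

lemma fps_binomial_1_minus_compose:
  assumes F: "fps_nth (F :: 'a::field_char_0 fps) 0 = 1"
  shows "F ^ t * fps_compose (fps_binomial (1 - of_nat t)) (F - 1) = F"
proof -
  have "F ^ t * fps_compose (fps_binomial (1 - of_nat t)) (F - 1)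
     = fps_compose (fps_binomial (of_nat t) * fps_binomial (1 - of_nat t)) (F - 1)"
    using F by (simp add: fps_compose_mult_distrib fps_binomial_of_nat_compose)
  also have "\<dots> = fps_compose (fps_binomial (of_nat 1)) (F - 1)"
    by (simp flip: fps_binomial_add_mult)
  also have "\<dots> = F" using F by (subst fps_binomial_of_nat_compose) auto
  finally show ?thesis .
qed

lemma Abs_fps_poly_mult:
  "Abs_fps (\<lambda>n. poly (fps_nth (F * G) n) t) =
     Abs_fps (\<lambda>n. poly (fps_nth F n) t) * Abs_fps (\<lambda>n. poly (fps_nth G n) t)"
  by (simp add: fps_eq_iff fps_mult_nth poly_sum)

text \<open>\<open>Q(z)\<^sup>t Q(-z)\<^sup>1\<^sup>-\<^sup>t = (1 + W)\<^sup>t Q(-z)\<close>, expanded by the binomial theorem. The binomial sum has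
  its range \<open>k \<le> t\<close>, the expansion of \<open>H\<^sub>n\<close> has the range \<open>k \<le> n\<close>; both may be enlarged to
  \<open>k \<le> max n t\<close>, as the binomial coefficient vanishes for \<open>t < k\<close> and the coefficient of the column
  for \<open>n < k\<close>.\<close>

lemma generating_function_at_nat:
  fixes H :: "nat \<Rightarrow> rat poly"
  assumes H: "Abs_fps (\<lambda>m. smult (1 / fact m) (H m)) =
              fps_gpow (Q a b fps_X) [:0, 1:] * fps_gpow (Q a b (- fps_X)) (1 - [:0, 1:])"
  shows "poly (H n) (of_nat t) =
    (\<Sum>k\<le>n. fact n / fact k * fps_nth (column a b k) n * falling (of_nat t) k)"
proof -
  let ?p = "Q a b fps_X :: rat fps" and ?q = "Q a b (- fps_X) :: rat fps"
  let ?B = "fps_compose (fps_binomial (1 - of_nat t)) (?q - 1)"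
  let ?W = "?p / ?q - 1"
  have "Abs_fps (\<lambda>m. poly (fps_nth (Abs_fps (\<lambda>m. smult (1 / fact m) (H m))) m) (of_nat t))
      = fps_compose (fps_binomial (of_nat t)) (?p - 1) * ?B"
    unfolding H Abs_fps_poly_mult poly_fps_gpow
    by (simp add: poly_Q_nth[where z' = fps_X] poly_Q_nth[where z' = "- fps_X"])
  also have "\<dots> = ?p ^ t * ?B" by (simp add: fps_binomial_of_nat_compose Q_nth_0)
  also have "?p ^ t = (?W + 1) ^ t * ?q ^ t"
  proof -
    have "?p ^ t = (?q * (?p / ?q)) ^ t" by (simp only: Q_quotient_mult)
    also have "\<dots> = (?p / ?q) ^ t * ?q ^ t" by (simp only: power_mult_distrib mult.commute)
    finally show ?thesis by (simp only: diff_add_cancel)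
  qed
  also have "\<dots> * ?B = (?W + 1) ^ t * ?q"
    by (simp only: mult.assoc fps_binomial_1_minus_compose[OF Q_nth_0(2)])
  also have "\<dots> = (\<Sum>k\<le>t. of_nat (t choose k) * column a b k)"
    unfolding binomial_ring sum_distrib_right column_def
    by (intro sum.cong refl)
      (simp only: power_one mult_1_left mult.assoc mult.commute mult.left_commute)
  finally have "fps_nth (Abs_fps (\<lambda>m. poly (fps_nth (Abs_fps (\<lambda>m. smult (1 / fact m) (H m))) m)
      (of_nat t))) n = fps_nth (\<Sum>k\<le>t. of_nat (t choose k) * column a b k) n"
    by (rule arg_cong)
  then have "poly (H n) (of_nat t) / fact n =
      (\<Sum>k\<le>t. of_nat (t choose k) * fps_nth (column a b k) n)"
    by (simp add: fps_sum_nth of_nat_fps_nth_mult)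
  also have "\<dots> = (\<Sum>k\<le>max n t. of_nat (t choose k) * fps_nth (column a b k) n)"
    by (rule sum.mono_neutral_left) auto
  also have "\<dots> = (\<Sum>k\<le>n. of_nat (t choose k) * fps_nth (column a b k) n)"
    by (rule sum.mono_neutral_right) (auto simp: column_nth_eq_0)
  finally have "poly (H n) (of_nat t) = fact n * \<dots>" by (simp add: field_simps)
  then show ?thesis by (simp add: sum_distrib_left falling_of_nat mult_ac)
qed

section \<open>Passing to powers of the variable\<close>

lemma coeff_falling:
  "coeff (falling [:0, 1::'a::comm_ring_1:] i) k = (- 1) ^ (i + k) * of_nat (stirling i k)"
proof (induction i arbitrary: k)
  case 0
  then show ?case by (cases k) (simp_all add: falling_def)
next
  case (Suc i)
  have "falling [:0, 1::'a:] (Suc i)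
      = pCons 0 (falling [:0, 1:] i) - smult (of_nat i) (falling [:0, 1:] i)"
    by (simp add: falling_def of_nat_poly algebra_simps)
  then have "coeff (falling [:0, 1::'a:] (Suc i)) k
      = (if k = 0 then 0 else coeff (falling [:0, 1:] i) (k - 1))
        - of_nat i * coeff (falling [:0, 1:] i) k"
    by (cases k) simp_all
  moreover have "i = 0 \<or> stirling i 0 = 0" by (cases i) simp_all
  ultimately show ?case by (cases k) (auto simp: Suc algebra_simps)
qed

section \<open>The lattice path formula\<close>

theorem theorem4:
  fixes a b :: int and n :: nat
    and H :: "nat \<Rightarrow> rat poly" and c :: "nat \<Rightarrow> nat \<Rightarrow> rat"
  assumes "a > 0" and "b > 0"
    and H: "Abs_fps (\<lambda>m. smult (1 / fact m) (H m)) =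
              fps_gpow (Q a b fps_X) [:0, 1:] * fps_gpow (Q a b (- fps_X)) (1 - [:0, 1:])"
    and c: "\<And>m. H m = (\<Sum>k\<le>m. smult (c m k) (falling [:0, 1:] k))"
  shows "(\<forall>k\<le>n. of_int (\<sigma> a b n k) = c n k \<and>
                c n k = fact n / fact k *
                  fps_nth (Q a b (- fps_X) * (Q a b fps_X / Q a b (- fps_X) - 1) ^ k) n) \<and>
         (\<forall>k. coeff (H n) k =
                (\<Sum>i\<le>n. (- 1) ^ (i + k) * of_int (\<sigma> a b n i) * of_nat (stirling i k)))"
proof -
  have c_column: "c n k = fact n / fact k * fps_nth (column a b k) n" if "k \<le> n" for k
  proof (rule falling_coeffs_unique[OF _ that])
    fix t
    have "poly (H n) (of_nat t) = (\<Sum>k\<le>n. c n k * falling (of_nat t) k)"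
      by (simp add: c[of n] poly_sum poly_falling)
    then show "(\<Sum>k\<le>n. c n k * falling (of_nat t) k) =
        (\<Sum>k\<le>n. fact n / fact k * fps_nth (column a b k) n * falling (of_nat t) k)"
      using generating_function_at_nat[OF H] by simp
  qed
  then have c_\<sigma>: "c n k = of_int (\<sigma> a b n k)" if "k \<le> n" for k
    using that by (simp add: \<sigma>_eq_column)
  have "coeff (H n) k = (\<Sum>i\<le>n. c n i * ((- 1) ^ (i + k) * of_nat (stirling i k)))" for k
    by (simp add: c[of n] coeff_sum coeff_falling)
  then have "coeff (H n) k = (\<Sum>i\<le>n. (- 1) ^ (i + k) * of_int (\<sigma> a b n i) * of_nat (stirling i k))" for k
    by (simp add: c_\<sigma> mult_ac)
  with c_column c_\<sigma> show ?thesis by (simp add: column_def)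
qed

end
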